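(* As $N\to\infty$ through odd positive integers, $$\rho(\mathrm{Maj}_N)=\frac{\gamma}{\sqrt N}\,(1+o(1)),$$ where $\gamma>0$ is the only real number satisfying $\int_0^\gamma e^{\frac{u^2}{2}}\,du=\sqrt{\frac{\pi}{2}}$.
   Context: Here $[N]=\{1,\dots,N\}$ and $\{\pm1\}^N$ carries the normalized counting measure, $\mathbb{E}[f]=2^{-N}\sum_{x\in\{\pm1\}^N}f(x)$. For $f\colon\{\pm1\}^N\to\mathbb{R}$ and $S\subset[N]$ put $x^S=\prod_{k\in S}x_k$ ($x^\emptyset=1$), $\widehat f(S)=\mathbb{E}[f(x)x^S]$ and $\|f\|_\infty=\max_x|f(x)|$. The Boolean radius $\rho(f)$ of a nonconstant $f$ is the unique positive real number $\rho$ with $\sum_{S\subset[N]}|\widehat f(S)|\rho^{|S|}=\|f\|_\infty$. For $N$ odd, the majority function is $\mathrm{Maj}_N\colon\{\pm1\}^N\to\{\pm1\}$, $\mathrm{Maj}_N(x)=\operatorname{sign}(x_1+\dots+x_N)$. *)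

theory Defs
  imports "HOL-Analysis.Analysis" "HOL-Library.Landau_Symbols"
begin

text \<open>
  Points of the Boolean cube are functions on \<open>{1..N}\<close>, made extensional so that the cube has
  exactly \<open>2 ^ N\<close> elements. Functions on the cube have type \<open>(nat \<Rightarrow> real) \<Rightarrow> real\<close>; their values
  off the cube are irrelevant.
\<close>

definition boolean_cube :: "nat \<Rightarrow> (nat \<Rightarrow> real) set" where
  "boolean_cube N = {1..N} \<rightarrow>\<^sub>E {-1, 1}"

definition cube_expectation :: "nat \<Rightarrow> ((nat \<Rightarrow> real) \<Rightarrow> real) \<Rightarrow> real" where
  "cube_expectation N f = (\<Sum>x\<in>boolean_cube N. f x) / 2 ^ N"

definition fourier_walsh :: "nat \<Rightarrow> ((nat \<Rightarrow> real) \<Rightarrow> real) \<Rightarrow> nat set \<Rightarrow> real" where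
  "fourier_walsh N f S = cube_expectation N (\<lambda>x. f x * (\<Prod>k\<in>S. x k))"

definition cube_sup_norm :: "nat \<Rightarrow> ((nat \<Rightarrow> real) \<Rightarrow> real) \<Rightarrow> real" where
  "cube_sup_norm N f = Max ((\<lambda>x. \<bar>f x\<bar>) ` boolean_cube N)"

text \<open>Meaningful for \<open>f\<close> nonconstant on the cube only.\<close>

definition boolean_radius :: "nat \<Rightarrow> ((nat \<Rightarrow> real) \<Rightarrow> real) \<Rightarrow> real" where
  "boolean_radius N f =
     (THE \<rho>. \<rho> > 0 \<and> (\<Sum>S\<in>Pow {1..N}. \<bar>fourier_walsh N f S\<bar> * \<rho> ^ card S) = cube_sup_norm N f)"

text \<open>Used for odd \<open>N\<close> only, where the sum never vanishes on the cube.\<close>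

definition majority :: "nat \<Rightarrow> (nat \<Rightarrow> real) \<Rightarrow> real" where
  "majority N x = sgn (\<Sum>k=1..N. x k)"

end

theory Submission
  imports Defs
begin

text \<open>
  Write \<open>N = 2 * m + 1\<close>. Everything rests on a closed form for the function whose level set at
  height 1 defines the radius:
  \<open>(\<Sum>S. \<bar>fourier_walsh N (majority N) S\<bar> * \<rho> ^ card S) = N * c * (\<integral>t=0..\<rho>. (1 + t\<^sup>2) ^ m)\<close>,
  where \<open>c = (2 * m choose m) / 4 ^ m\<close> is the probability that \<open>2 * m\<close> random signs sum to zero.
  Substituting \<open>\<rho> = g / sqrt N\<close>, the right-hand side becomes
  \<open>sqrt N * c * (\<integral>u=0..g. (1 + u\<^sup>2 / N) ^ m)\<close>. Wallis' product gives \<open>sqrt N * c \<longlonglongrightarrow> sqrt (2 / pi)\<close>, and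
  the integrand tends to \<open>exp (u\<^sup>2 / 2)\<close> without ever exceeding it, so by dominated convergence the
  rescaled functions converge pointwise to \<open>sqrt (2 / pi) * (\<integral>u=0..g. exp (u\<^sup>2 / 2))\<close>. All of these
  functions are strictly increasing in \<open>g\<close>, and therefore the points where they take the value 1
  converge as well, to the point \<open>\<gamma>\<close> where the limit is 1.

  The closed form comes from the Fourier coefficients of the majority function. Even levels vanish
  because the function is odd. On an odd level, summing over one coordinate \<open>i \<in> S\<close> leaves the
  sum of the character of \<open>S - {i}\<close> over the balanced sign vectors on the other \<open>2 * m\<close> coordinates,
  since a single vote matters exactly when the other votes are tied. Such a sum depends on
  the size of the set only. Inserting the factor \<open>\<Sum>i. y i\<close>, which is zero on balanced vectors,
  yields a two-step recurrence in that size (lemma \<open>balanced_walsh_sum_recurrence\<close>), whose solution is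
  \<open>(-1) ^ j * (2 * m choose m) * (m choose j) / (2 * m choose 2 * j)\<close> at size \<open>2 * j\<close>. The factor
  \<open>2 * m choose 2 * j\<close> then cancels against the number of sets of size \<open>2 * j + 1\<close>, up to
  \<open>N / (2 * j + 1)\<close>, and this leaves the Taylor coefficients of the integral.
\<close>

section \<open>Characters summed over balanced sign vectors\<close>

text \<open>
  The index set is arbitrary, unlike in \<^const>\<open>boolean_cube\<close>, so that a coordinate can be split off.
\<close>

definition sign_cube :: "'a set \<Rightarrow> ('a \<Rightarrow> real) set" where
  "sign_cube J = J \<rightarrow>\<^sub>E {-1, 1}"

definition balanced_walsh_sum :: "'a set \<Rightarrow> 'a set \<Rightarrow> real" where
  "balanced_walsh_sum J T = (\<Sum>y | y \<in> sign_cube J \<and> sum y J = 0. \<Prod>k\<in>T. y k)"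

lemma finite_sign_cube: "finite J \<Longrightarrow> finite (sign_cube J)"
  unfolding sign_cube_def by (intro finite_PiE) auto

lemma sign_cube_square:
  assumes "y \<in> sign_cube J" "i \<in> J"
  shows "y i * y i = 1"
proof -
  have "y i = -1 \<or> y i = 1" using assms by (auto simp: sign_cube_def PiE_iff)
  then show ?thesis by auto
qed

text \<open>
  Permuting the coordinates permutes the balanced sign vectors. With the next lemma this shows that
  the sum depends only on how many coordinates the character involves.
\<close>

lemma balanced_walsh_sum_permute:
  assumes p: "bij_betw p J J" and T: "T \<subseteq> J"
  shows "balanced_walsh_sum J (p ` T) = balanced_walsh_sum J T"
proof -
  let ?q = "inv_into J p"
  have q: "bij_betw ?q J J" by (rule bij_betw_inv_into[OF p])
  have pq: "p (?q k) = k" if "k \<in> J" for k using p that by (simp add: bij_betw_inv_into_right)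
  have qp: "?q (p k) = k" if "k \<in> J" for k using p that by (simp add: bij_betw_inv_into_left)
  have pJ: "p k \<in> J" if "k \<in> J" for k using p that by (rule bij_betw_apply)
  have qJ: "?q k \<in> J" if "k \<in> J" for k using q that by (rule bij_betw_apply)
  have balanced: "sum (restrict (y \<circ> r) J) J = sum y J" if "bij_betw r J J" for y :: "'a \<Rightarrow> real" and r
  proof -
    have "sum (restrict (y \<circ> r) J) J = (\<Sum>k\<in>J. y (r k))" by (intro sum.cong) auto
    also have "\<dots> = sum y J" using that by (rule sum.reindex_bij_betw)
    finally show ?thesis .
  qed
  have prods: "(\<Prod>k\<in>p ` T. y k) = (\<Prod>k\<in>T. restrict (y \<circ> p) J k)" for y :: "'a \<Rightarrow> real"
  proof -
    have "inj_on p T" using p T by (meson bij_betw_imp_inj_on inj_on_subset)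
    then have "(\<Prod>k\<in>p ` T. y k) = (\<Prod>k\<in>T. y (p k))" by (simp add: prod.reindex)
    also have "\<dots> = (\<Prod>k\<in>T. restrict (y \<circ> p) J k)" using T by (intro prod.cong) auto
    finally show ?thesis .
  qed
  show ?thesis unfolding balanced_walsh_sum_def
  proof (rule sum.reindex_bij_witness[where j = "\<lambda>y. restrict (y \<circ> p) J" and i = "\<lambda>y. restrict (y \<circ> ?q) J"], goal_cases)
    case (1 y)
    then show ?case unfolding sign_cube_def
      by (intro ext) (auto simp: PiE_iff extensional_def pq qJ)
  next
    case (2 y)
    then show ?case using balanced[OF p, of y] by (auto simp: sign_cube_def PiE_iff pJ)
  next
    case (3 y)
    then show ?case unfolding sign_cube_def
      by (intro ext) (auto simp: PiE_iff extensional_def qp pJ)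
  next
    case (4 y)
    then show ?case using balanced[OF q, of y] by (auto simp: sign_cube_def PiE_iff qJ)
  next
    case (5 y)
    then show ?case by (simp only: prods)
  qed
qed

lemma balanced_walsh_sum_cong_card:
  assumes fin: "finite J" and T: "T \<subseteq> J" "T' \<subseteq> J" "card T = card T'"
  shows "balanced_walsh_sum J T = balanced_walsh_sum J T'"
proof -
  have finT: "finite T" "finite T'" using fin T finite_subset by auto
  obtain f where f: "bij_betw f T T'" using finite_same_card_bij[OF finT T(3)] by blast
  have "card (J - T) = card (J - T')" using finT T by (simp add: card_Diff_subset)
  then obtain g where g: "bij_betw g (J - T) (J - T')"
    using finite_same_card_bij[of "J - T" "J - T'"] fin by auto
  define p where "p k = (if k \<in> T then f k else g k)" for k
  have "bij_betw p T T'" using f by (subst bij_betw_cong[where g = f]) (auto simp: p_def)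
  moreover have "bij_betw p (J - T) (J - T')" using g by (subst bij_betw_cong[where g = g]) (auto simp: p_def)
  ultimately have "bij_betw p (T \<union> (J - T)) (T' \<union> (J - T'))"
    by (rule bij_betw_combine) auto
  then have p: "bij_betw p J J" using T by (simp add: Un_absorb1)
  have "p ` T = T'" using f by (auto simp: p_def bij_betw_def)
  with balanced_walsh_sum_permute[OF p T(1)] show ?thesis by simp
qed

text \<open>
  Both sums together equal \<open>\<Sum>y. (\<Sum>i\<in>J. y i) * (\<Prod>k\<in>T. y k)\<close>: multiplying the character of \<open>T\<close> by
  \<open>y i\<close> removes \<open>i\<close> from \<open>T\<close> or adds it, because \<open>y i * y i = 1\<close>. On balanced vectors the first
  factor is zero.
\<close>

lemma balanced_walsh_sum_recurrence:
  assumes fin: "finite J" and T: "T \<subseteq> J"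
  shows "(\<Sum>i\<in>T. balanced_walsh_sum J (T - {i})) + (\<Sum>i\<in>J - T. balanced_walsh_sum J (insert i T)) = 0"
proof -
  let ?B = "{y. y \<in> sign_cube J \<and> sum y J = 0}"
  have finT: "finite T" using fin T finite_subset by auto
  have "(\<Sum>i\<in>T. balanced_walsh_sum J (T - {i})) = (\<Sum>i\<in>T. \<Sum>y\<in>?B. y i * (\<Prod>k\<in>T. y k))"
    unfolding balanced_walsh_sum_def
  proof (intro sum.cong refl)
    fix i y assume i: "i \<in> T" and y: "y \<in> ?B"
    have "y i * (\<Prod>k\<in>T. y k) = (y i * y i) * (\<Prod>k\<in>T - {i}. y k)"
      using i finT by (simp add: prod.remove)
    also have "y i * y i = 1" using y i T by (intro sign_cube_square[of y J]) auto
    finally show "(\<Prod>k\<in>T - {i}. y k) = y i * (\<Prod>k\<in>T. y k)" by simp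
  qed
  moreover have "(\<Sum>i\<in>J - T. balanced_walsh_sum J (insert i T))
      = (\<Sum>i\<in>J - T. \<Sum>y\<in>?B. y i * (\<Prod>k\<in>T. y k))"
    unfolding balanced_walsh_sum_def using finT by (intro sum.cong refl) auto
  moreover have "(\<Sum>i\<in>T. \<Sum>y\<in>?B. y i * (\<Prod>k\<in>T. y k)) + (\<Sum>i\<in>J - T. \<Sum>y\<in>?B. y i * (\<Prod>k\<in>T. y k))
      = (\<Sum>i\<in>J. \<Sum>y\<in>?B. y i * (\<Prod>k\<in>T. y k))"
    using sum.subset_diff[OF T fin, of "\<lambda>i. \<Sum>y\<in>?B. y i * (\<Prod>k\<in>T. y k)"] by simp
  moreover have "(\<Sum>i\<in>J. \<Sum>y\<in>?B. y i * (\<Prod>k\<in>T. y k)) = (\<Sum>y\<in>?B. sum y J * (\<Prod>k\<in>T. y k))"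
    by (subst sum.swap) (simp only: sum_distrib_right)
  moreover have "\<dots> = 0" by (intro sum.neutral) auto
  ultimately show ?thesis by simp
qed

lemma sum_sign_cube:
  assumes "finite J" "y \<in> sign_cube J"
  shows "sum y J = real (card J) - 2 * real (card {i \<in> J. y i = -1})"
proof -
  have "sum y J = (\<Sum>i\<in>J. 1 - 2 * (if y i = -1 then 1 else 0))"
    using assms(2) by (intro sum.cong) (auto simp: sign_cube_def PiE_iff)
  also have "\<dots> = real (card J) - 2 * real (card {i \<in> J. y i = -1})"
    using assms(1) by (simp add: sum_subtractf sum_distrib_left[symmetric] sum.If_cases Collect_conj_eq)
  finally show ?thesis .
qed

text \<open>
  A sign vector is balanced iff exactly half of its entries are negative, so balanced vectors
  correspond to the \<open>m\<close>-element subsets of \<open>J\<close>.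
\<close>

lemma balanced_walsh_sum_empty:
  assumes fin: "finite J" and J: "card J = 2 * m"
  shows "balanced_walsh_sum J {} = real ((2 * m) choose m)"
proof -
  let ?neg = "\<lambda>y::'a \<Rightarrow> real. {i \<in> J. y i = -1}"
  let ?y = "\<lambda>A. restrict (\<lambda>i. if i \<in> A then -1 else 1::real) J"
  have s: "sum y J = 2 * real m - 2 * real (card (?neg y))" if "y \<in> sign_cube J" for y :: "'a \<Rightarrow> real"
    using sum_sign_cube[OF fin that] J by simp
  have yneg: "?y (?neg y) = y" if "y \<in> sign_cube J" for y
    using that by (auto simp: sign_cube_def PiE_iff extensional_def fun_eq_iff)
  have negy: "?neg (?y A) = A" if "A \<subseteq> J" for A
    using that by (auto split: if_splits)
  have "bij_betw ?neg {y. y \<in> sign_cube J \<and> sum y J = 0} {A. A \<subseteq> J \<and> card A = m}"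
  proof (rule bij_betw_byWitness[where f' = ?y])
    show "\<forall>y\<in>{y \<in> sign_cube J. sum y J = 0}. ?y (?neg y) = y" using yneg by blast
    show "\<forall>A\<in>{A. A \<subseteq> J \<and> card A = m}. ?neg (?y A) = A" using negy by blast
    show "?neg ` {y \<in> sign_cube J. sum y J = 0} \<subseteq> {A. A \<subseteq> J \<and> card A = m}"
      using s by auto
    show "?y ` {A. A \<subseteq> J \<and> card A = m} \<subseteq> {y \<in> sign_cube J. sum y J = 0}"
    proof (rule image_subsetI)
      fix A assume A: "A \<in> {A. A \<subseteq> J \<and> card A = m}"
      have c: "?y A \<in> sign_cube J" by (auto simp: sign_cube_def PiE_iff)
      have "sum (?y A) J = 0" using s[OF c] negy[of A] A by simp
      with c show "?y A \<in> {y \<in> sign_cube J. sum y J = 0}" by simp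
    qed
  qed
  from bij_betw_same_card[OF this] show ?thesis
    using n_subsets[OF fin, of m] J by (simp add: balanced_walsh_sum_def)
qed

text \<open>
  The recurrence satisfied by the claimed closed form, up to its alternating sign.
\<close>

lemma binomial_ratio_step:
  assumes "j < m"
  shows "(2 * real m - 2 * real j - 1) * (real (m choose Suc j) / real ((2 * m) choose (2 * Suc j)))
    = (2 * real j + 1) * (real (m choose j) / real ((2 * m) choose (2 * j)))"
proof -
  have step: "real (Suc k) * real (n choose Suc k) = (real n - real k) * real (n choose k)" if "k \<le> n" for n k
  proof -
    have "Suc k * (n choose Suc k) = (n - k) * (n choose k)"
      by (simp only: binomial_absorption binomial_absorb_comp)
    then have "real (Suc k) * real (n choose Suc k) = real (n - k) * real (n choose k)"
      by (simp only: flip: of_nat_mult)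
    then show ?thesis using that by (simp only: of_nat_diff)
  qed
  define a b c d e where "a = real (m choose j)" and "b = real ((2 * m) choose (2 * j))"
    and "c = real ((2 * m) choose (2 * j + 1))" and "d = real ((2 * m) choose (2 * Suc j))"
    and "e = real (m choose Suc j)"
  have pos: "b > 0" "d > 0" using assms by (simp_all add: b_def d_def)
  have "(real j + 1) * e = (real m - real j) * a"
    using step[of j m] assms by (simp add: a_def e_def add.commute)
  moreover have "(2 * real j + 1) * c = (2 * real m - 2 * real j) * b"
    using step[of "2 * j" "2 * m"] assms by (simp add: b_def c_def add.commute)
  moreover have "(2 * real j + 2) * d = (2 * real m - 2 * real j - 1) * c"
    using step[of "2 * j + 1" "2 * m"] assms by (simp add: c_def d_def algebra_simps)
  ultimately have "(2 * real j + 2) * ((2 * real m - 2 * real j - 1) * e * b) =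
      (2 * real j + 2) * ((2 * real j + 1) * a * d)"
    by algebra
  then have "(2 * real m - 2 * real j - 1) * e * b = (2 * real j + 1) * a * d"
    by (subst (asm) mult_cancel_left) auto
  then have "(2 * real m - 2 * real j - 1) * (e / d) = (2 * real j + 1) * (a / b)"
    using pos by (simp add: frac_eq_eq)
  then show ?thesis by (simp only: a_def b_def d_def e_def)
qed

text \<open>
  Induction on \<open>j\<close>: the recurrence at a set \<open>U\<close> of odd size \<open>2 * j + 1\<close> links the common value at
  size \<open>2 * j\<close> to the common value at size \<open>2 * j + 2\<close>.
\<close>

lemma balanced_walsh_sum_even:
  assumes fin: "finite J" and J: "card J = 2 * m"
  shows "T \<subseteq> J \<Longrightarrow> card T = 2 * j \<Longrightarrow> balanced_walsh_sum J T =
    (-1) ^ j * real ((2 * m) choose m) * (real (m choose j) / real ((2 * m) choose (2 * j)))"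
proof (induction j arbitrary: T)
  case 0
  then have "T = {}" using fin finite_subset[of T J] by simp
  then show ?case using balanced_walsh_sum_empty[OF assms] by simp
next
  case (Suc j)
  let ?v = "(-1) ^ j * real ((2 * m) choose m) * (real (m choose j) / real ((2 * m) choose (2 * j)))"
  let ?K = "balanced_walsh_sum J"
  have finT: "finite T" using Suc.prems fin finite_subset by auto
  have jm: "j < m" using card_mono[OF fin Suc.prems(1)] Suc.prems J by simp
  obtain a where a: "a \<in> T" using Suc.prems by fastforce
  define U where "U = T - {a}"
  have U: "finite U" "U \<subseteq> J" "card U = 2 * j + 1" using Suc.prems a finT by (auto simp: U_def)
  have cJU: "real (card (J - U)) = 2 * real m - 2 * real j - 1"
    using U fin J jm by (simp add: card_Diff_subset of_nat_diff)
  have cU: "real (card U) = 2 * real j + 1" using U by simp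
  have "?K (U - {i}) = ?v" if "i \<in> U" for i
    using U that by (intro Suc.IH) auto
  moreover have "?K (insert i U) = ?K T" if "i \<in> J - U" for i
    using U that Suc.prems by (intro balanced_walsh_sum_cong_card fin) auto
  ultimately have "(2 * real j + 1) * ?v + (2 * real m - 2 * real j - 1) * ?K T = 0"
    using balanced_walsh_sum_recurrence[OF fin U(2)] cJU cU by simp
  then have "(2 * real m - 2 * real j - 1) * ?K T =
      - ((-1) ^ j * real ((2 * m) choose m) * ((2 * real j + 1) * (real (m choose j) / real ((2 * m) choose (2 * j)))))"
    by (simp only: eq_neg_iff_add_eq_0) (simp only: ac_simps)
  also have "\<dots> = (2 * real m - 2 * real j - 1) *
    ((-1) ^ Suc j * real ((2 * m) choose m) * (real (m choose Suc j) / real ((2 * m) choose (2 * Suc j))))"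
    by (subst binomial_ratio_step[OF jm, symmetric]) (simp only: power_Suc, algebra)
  finally show ?case using jm by (subst (asm) mult_cancel_left) linarith
qed

section \<open>Fourier coefficients of the majority function\<close>

lemma sum_sign_cube_insert:
  assumes "finite J" "i \<notin> J"
  shows "(\<Sum>x\<in>sign_cube (insert i J). F x) = (\<Sum>y\<in>sign_cube J. F (y(i := -1)) + F (y(i := 1)))"
proof -
  let ?g = "\<lambda>(b, y). y(i := b) :: 'a \<Rightarrow> real"
  have "(\<Sum>x\<in>sign_cube (insert i J). F x) = (\<Sum>x\<in>?g ` ({-1, 1} \<times> sign_cube J). F x)"
    by (simp only: sign_cube_def PiE_insert_eq)
  also have "\<dots> = (\<Sum>p\<in>{-1, 1} \<times> sign_cube J. F (?g p))"
    unfolding sign_cube_def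
    using inj_combinator[OF assms(2), of "\<lambda>_. {-1, 1::real}"] by (subst sum.reindex) (simp_all add: comp_def)
  also have "\<dots> = (\<Sum>b\<in>{-1, 1}. \<Sum>y\<in>sign_cube J. F (y(i := b)))"
    by (simp add: sum.cartesian_product case_prod_unfold)
  also have "\<dots> = (\<Sum>y\<in>sign_cube J. F (y(i := -1)) + F (y(i := 1)))"
    by (simp add: sum.distrib)
  finally show ?thesis .
qed

text \<open>
  The probability that \<open>2 * m\<close> independent random signs sum to zero.
\<close>

definition central_probability :: "nat \<Rightarrow> real" where
  "central_probability m = real ((2 * m) choose m) / 4 ^ m"

text \<open>
  A coordinate \<open>i \<in> S\<close> contributes \<open>sgn (s + 1) - sgn (s - 1)\<close>, where \<open>s\<close> is the sum of the remaining
  coordinates. As \<open>s\<close> is even, this is 2 if \<open>s = 0\<close> and 0 otherwise.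
\<close>

lemma fourier_walsh_majority_odd:
  assumes S: "S \<subseteq> {1..2 * m + 1}" and card: "card S = 2 * j + 1"
  shows "fourier_walsh (2 * m + 1) (majority (2 * m + 1)) S =
    (-1) ^ j * central_probability m * (real (m choose j) / real ((2 * m) choose (2 * j)))"
proof -
  have finS: "finite S" using S finite_subset by auto
  obtain i where i: "i \<in> S" using card by fastforce
  define J where "J = {1..2 * m + 1} - {i}"
  define T where "T = S - {i}"
  have J: "finite J" "i \<notin> J" "insert i J = {1..2 * m + 1}" "card J = 2 * m"
    using i S by (auto simp: J_def)
  have T: "T \<subseteq> J" "card T = 2 * j" "finite T" "i \<notin> T" "S = insert i T"
    using i S card finS by (auto simp: J_def T_def)
  define F where "F x = majority (2 * m + 1) x * (\<Prod>k\<in>S. x k)" for x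
  have F: "F (y(i := b)) = sgn (b + sum y J) * b * (\<Prod>k\<in>T. y k)" for y b
  proof -
    have "sum (y(i := b)) (insert i J) = b + sum y J"
      using J(1,2) by (simp, intro sum.cong) auto
    moreover have "prod (y(i := b)) (insert i T) = b * (\<Prod>k\<in>T. y k)"
      using T(3,4) by (simp, intro disjI2 prod.cong) auto
    ultimately show ?thesis 
      by (simp only: F_def majority_def J(3)[symmetric] T(5) mult.assoc)
  qed
  have pair: "F (y(i := -1)) + F (y(i := 1)) = (if sum y J = 0 then 2 * (\<Prod>k\<in>T. y k) else 0)"
    if y: "y \<in> sign_cube J" for y
  proof -
    \<comment> \<open>\<open>2 * l\<close> is the sum of the other coordinates; working with an integer gives \<open>\<bar>l\<bar> \<ge> 1\<close> unless \<open>l = 0\<close>.\<close>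
    define l where "l = int m - int (card {i \<in> J. y i = -1})"
    have s: "sum y J = 2 * real_of_int l" using sum_sign_cube[OF J(1) y] J(4) by (simp add: l_def)
    consider "l = 0" | "l \<ge> 1" | "l \<le> -1" by linarith
    then show ?thesis
    proof cases
      case 1
      then show ?thesis by (simp add: F s)
    next
      case 2
      then have "real_of_int l \<ge> 1" by simp
      then show ?thesis by (simp add: F s sgn_if)
    next
      case 3
      then have "real_of_int l \<le> -1" by linarith
      then show ?thesis by (simp add: F s sgn_if)
    qed
  qed
  have "(\<Sum>x\<in>boolean_cube (2 * m + 1). F x) = (\<Sum>x\<in>sign_cube (insert i J). F x)"
    by (simp only: boolean_cube_def sign_cube_def J(3))
  also have "\<dots> = (\<Sum>y\<in>sign_cube J. if sum y J = 0 then 2 * (\<Prod>k\<in>T. y k) else 0)"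
    using sum_sign_cube_insert[OF J(1,2), of F] pair by simp
  also have "\<dots> = 2 * balanced_walsh_sum J T"
    unfolding balanced_walsh_sum_def sum_distrib_left
    using finite_sign_cube[OF J(1)] by (intro sum.mono_neutral_cong_right) auto
  finally have "fourier_walsh (2 * m + 1) (majority (2 * m + 1)) S = 2 * balanced_walsh_sum J T / 2 ^ (2 * m + 1)"
    by (simp add: fourier_walsh_def cube_expectation_def F_def)
  also have "\<dots> = balanced_walsh_sum J T / 4 ^ m"
    by (simp add: power_mult)
  finally show ?thesis
    by (simp add: balanced_walsh_sum_even[OF J(1,4) T(1,2)] central_probability_def)
qed

text \<open>
  Negating \<open>x\<close> changes the sign of the majority but not of a product over an even number of
  coordinates.
\<close>

lemma fourier_walsh_majority_even:
  assumes S: "S \<subseteq> {1..N}" and card: "even (card S)"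
  shows "fourier_walsh N (majority N) S = 0"
proof -
  define F where "F x = majority N x * (\<Prod>k\<in>S. x k)" for x
  define neg where "neg x = restrict (\<lambda>k. - x k) {1..N}" for x :: "nat \<Rightarrow> real"
  have neg: "neg x \<in> boolean_cube N" "neg (neg x) = x" if "x \<in> boolean_cube N" for x
    using that by (auto simp: neg_def boolean_cube_def PiE_iff extensional_def fun_eq_iff)
  have F_neg: "F (neg x) = - F x" for x
  proof -
    have "sum (neg x) {1..N} = - sum x {1..N}" by (simp add: neg_def sum_negf)
    moreover have "(\<Prod>k\<in>S. neg x k) = (\<Prod>k\<in>S. - x k)"
      using S by (intro prod.cong) (auto simp: neg_def)
    moreover have "(\<Prod>k\<in>S. - x k) = (\<Prod>k\<in>S. x k)"
      using card by (simp add: prod_uminus)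
    ultimately show ?thesis by (simp add: F_def majority_def sgn_minus)
  qed
  have "(\<Sum>x\<in>boolean_cube N. F x) = (\<Sum>x\<in>boolean_cube N. - F x)"
    by (rule sum.reindex_bij_witness[where i = neg and j = neg]) (auto simp: neg F_neg)
  then have "(\<Sum>x\<in>boolean_cube N. F x) = 0" by (simp add: sum_negf)
  then show ?thesis by (simp add: fourier_walsh_def cube_expectation_def F_def)
qed

lemma sum_Pow_card:
  fixes h :: "nat \<Rightarrow> real"
  assumes "finite I"
  shows "(\<Sum>S\<in>Pow I. h (card S)) = (\<Sum>k\<le>card I. real (card I choose k) * h k)"
proof -
  have "(\<Sum>k\<le>card I. \<Sum>S | S \<in> Pow I \<and> card S = k. h (card S)) = (\<Sum>S\<in>Pow I. h (card S))"
    using assms by (intro sum.group) (auto intro: card_mono)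
  moreover have "(\<Sum>S | S \<in> Pow I \<and> card S = k. h (card S)) = real (card I choose k) * h k" for k
    using n_subsets[OF assms, of k] by simp
  ultimately show ?thesis by (simp only:)
qed

text \<open>
  The \<open>2 * m + 1 choose 2 * j + 1\<close> sets on level \<open>2 * j + 1\<close> have coefficients of the same modulus, and
  \<open>(2 * m + 1 choose 2 * j + 1) / (2 * m choose 2 * j) = (2 * m + 1) / (2 * j + 1)\<close>.
\<close>

lemma walsh_majorant_majority:
  "(\<Sum>S\<in>Pow {1..2 * m + 1}. \<bar>fourier_walsh (2 * m + 1) (majority (2 * m + 1)) S\<bar> * \<rho> ^ card S) =
    real (2 * m + 1) * central_probability m *
      (\<Sum>j\<le>m. real (m choose j) * \<rho> ^ (2 * j + 1) / real (2 * j + 1))"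
proof -
  let ?N = "2 * m + 1"
  define h where "h k = (if even k then 0 else central_probability m *
    (real (m choose (k div 2)) / real ((2 * m) choose (k - 1)))) * \<rho> ^ k" for k
  have c: "central_probability m \<ge> 0" by (simp add: central_probability_def)
  have "\<bar>fourier_walsh ?N (majority ?N) S\<bar> * \<rho> ^ card S = h (card S)" if "S \<in> Pow {1..?N}" for S
  proof (cases "even (card S)")
    case True
    then show ?thesis using that fourier_walsh_majority_even[of S ?N] by (simp add: h_def)
  next
    case False
    then obtain j where "card S = 2 * j + 1" by (elim oddE)
    then show ?thesis using that fourier_walsh_majority_odd[of S m j] c
      by (simp add: h_def abs_mult)
  qed
  then have "(\<Sum>S\<in>Pow {1..?N}. \<bar>fourier_walsh ?N (majority ?N) S\<bar> * \<rho> ^ card S) =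
      (\<Sum>S\<in>Pow {1..?N}. h (card S))" by (intro sum.cong) auto
  also have "\<dots> = (\<Sum>k\<le>Suc (2 * m). real (?N choose k) * h k)"
    by (subst sum_Pow_card) auto
  also have "\<dots> = (\<Sum>j\<le>m. real (?N choose (2 * j + 1)) * h (2 * j + 1))"
    by (subst sum.in_pairs_0) (simp add: h_def)
  also have "\<dots> = (\<Sum>j\<le>m. real ?N * central_probability m *
      (real (m choose j) * \<rho> ^ (2 * j + 1) / real (2 * j + 1)))"
  proof (intro sum.cong refl)
    fix j assume "j \<in> {..m}"
    then have b: "real ((2 * m) choose (2 * j)) > 0" by simp
    have "real (2 * j + 1) * real (?N choose (2 * j + 1)) = real ?N * real ((2 * m) choose (2 * j))"
      using Suc_times_binomial[of "2 * j" "2 * m"] by (simp only: Suc_eq_plus1 flip: of_nat_mult)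
    then have "real (?N choose (2 * j + 1)) = real ?N * real ((2 * m) choose (2 * j)) / real (2 * j + 1)"
      by (subst nonzero_eq_divide_eq) (simp, simp only: mult.commute)
    then show "real (?N choose (2 * j + 1)) * h (2 * j + 1) = real ?N * central_probability m *
      (real (m choose j) * \<rho> ^ (2 * j + 1) / real (2 * j + 1))"
      using b by (simp add: h_def)
  qed
  finally show ?thesis by (simp only: sum_distrib_left)
qed

section \<open>Asymptotics of the central binomial coefficient\<close>

lemma central_probability_pos: "central_probability m > 0"
  by (simp add: central_probability_def)

lemma central_probability_Suc:
  "central_probability (Suc m) = central_probability m * (2 * real m + 1) / (2 * real m + 2)"
proof -
  define x y z where "x = real ((2 * m + 2) choose Suc m)" and "y = real ((2 * m + 1) choose m)"
    and "z = real ((2 * m) choose m)"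
  have "Suc m * ((2 * m + 2) choose Suc m) = (2 * m + 2) * ((2 * m + 1) choose m)"
    using Suc_times_binomial[of m "2 * m + 1"] by simp
  then have "real (Suc m) * x = real (2 * m + 2) * y"
    unfolding x_def y_def by (simp only: flip: of_nat_mult)
  also have "\<dots> = real (Suc m) * (2 * y)" by (simp add: algebra_simps)
  finally have x: "x = 2 * y" by (subst (asm) mult_cancel_left) simp
  have "(m + 1) * ((2 * m + 1) choose m) = (2 * m + 1) * ((2 * m) choose m)"
    using binomial_absorb_comp[of "2 * m + 1" m] by simp
  then have "real (m + 1) * y = real (2 * m + 1) * z"
    unfolding y_def z_def by (simp only: flip: of_nat_mult)
  then have y: "y = (2 * real m + 1) * z / (real m + 1)" by (simp add: field_simps)
  have "central_probability (Suc m) = x / (4 * 4 ^ m)"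
    by (simp add: central_probability_def x_def)
  also have "\<dots> = z / 4 ^ m * (2 * real m + 1) / (2 * real m + 2)"
    by (simp add: x y divide_simps)
  finally show ?thesis by (simp add: central_probability_def z_def)
qed

text \<open>
  The central probability is \<open>\<Prod>k=1..m. (2 * k - 1) / (2 * k)\<close>. In its square, regrouping
  adjacent odd factors leaves one factor \<open>2 * m + 1\<close> to be supplied and otherwise gives the
  reciprocal of a partial product of Wallis' formula for \<open>pi / 2\<close>.
\<close>

lemma central_probability_wallis:
  "real (2 * m + 1) * (central_probability m)\<^sup>2 = inverse (\<Prod>k=1..m. (4 * real k ^ 2) / (4 * real k ^ 2 - 1))"
proof (induction m)
  case 0
  then show ?case by (simp add: central_probability_def)
next
  case (Suc m)
  have "real (2 * Suc m + 1) * (central_probability (Suc m))\<^sup>2 =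
      (real (2 * m + 1) * (central_probability m)\<^sup>2) * ((2 * real m + 1) * (2 * real m + 3) / (2 * real m + 2)\<^sup>2)"
    by (simp add: central_probability_Suc power_divide power_mult_distrib power2_eq_square mult_ac add_ac)
  also have "(2 * real m + 1) * (2 * real m + 3) / (2 * real m + 2)\<^sup>2 =
      inverse ((4 * real (Suc m) ^ 2) / (4 * real (Suc m) ^ 2 - 1))"
    by (simp add: power2_eq_square algebra_simps)
  finally have "real (2 * Suc m + 1) * (central_probability (Suc m))\<^sup>2 =
      inverse (\<Prod>k=1..m. (4 * real k ^ 2) / (4 * real k ^ 2 - 1)) *
      inverse ((4 * real (Suc m) ^ 2) / (4 * real (Suc m) ^ 2 - 1))"
    by (simp only: Suc.IH)
  also have "\<dots> = inverse (\<Prod>k=1..Suc m. (4 * real k ^ 2) / (4 * real k ^ 2 - 1))"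
    by (subst prod.nat_ivl_Suc') (simp, simp only: inverse_mult_distrib mult.commute)
  finally show ?case .
qed

lemma central_probability_tendsto:
  "(\<lambda>m. sqrt (real (2 * m + 1)) * central_probability m) \<longlonglongrightarrow> sqrt (2 / pi)"
proof -
  have "(\<lambda>m. sqrt (inverse (\<Prod>k=1..m. (4 * real k ^ 2) / (4 * real k ^ 2 - 1)))) \<longlonglongrightarrow> sqrt (inverse (pi / 2))"
    by (intro tendsto_real_sqrt tendsto_inverse wallis) simp
  moreover have "sqrt (inverse (\<Prod>k=1..m. (4 * real k ^ 2) / (4 * real k ^ 2 - 1))) =
      sqrt (real (2 * m + 1)) * central_probability m" for m
    using central_probability_pos[of m]
    by (simp only: central_probability_wallis[symmetric] real_sqrt_mult real_sqrt_abs)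
  ultimately show ?thesis by simp
qed

section \<open>The equation defining the radius\<close>

text \<open>
  The integral \<open>\<integral>t=0..r. (1 + t\<^sup>2) ^ m\<close>, written as the polynomial that the Walsh expansion of the
  majority function produces.
\<close>

definition power_primitive :: "nat \<Rightarrow> real \<Rightarrow> real" where
  "power_primitive m r = (\<Sum>j\<le>m. real (m choose j) * r ^ (2 * j + 1) / real (2 * j + 1))"

lemma power_primitive_0 [simp]: "power_primitive m 0 = 0"
  by (simp add: power_primitive_def)

lemma has_derivative_power_primitive:
  "(power_primitive m has_real_derivative (1 + r\<^sup>2) ^ m) (at r)"
proof -
  have "((\<lambda>r. real (m choose j) * r ^ (2 * j + 1) / real (2 * j + 1)) has_real_derivative
      real (m choose j) * (r\<^sup>2) ^ j) (at r)" for j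
    by (rule derivative_eq_intros refl | simp)+ (simp add: power_mult[symmetric])
  then have "(power_primitive m has_real_derivative (\<Sum>j\<le>m. real (m choose j) * (r\<^sup>2) ^ j)) (at r)"
    unfolding power_primitive_def by (intro DERIV_sum) auto
  then show ?thesis using binomial_ring[of "r\<^sup>2" 1 m] by (simp add: add.commute)
qed

lemma strict_mono_if_derivative_pos:
  fixes f f' :: "real \<Rightarrow> real"
  assumes "\<And>x. (f has_real_derivative f' x) (at x)" "\<And>x. f' x > 0"
  shows "strict_mono f"
proof (rule strict_monoI)
  fix x y :: real assume "x < y"
  then show "f x < f y" by (rule DERIV_pos_imp_increasing) (use assms in blast)
qed

lemma strict_mono_power_primitive: "strict_mono (power_primitive m)"
  by (rule strict_mono_if_derivative_pos[OF has_derivative_power_primitive])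
    (auto intro!: zero_less_power add_pos_nonneg)

lemma power_primitive_ge: "r \<ge> 0 \<Longrightarrow> power_primitive m r \<ge> r"
  unfolding power_primitive_def
  using member_le_sum[of 0 "{..m}" "\<lambda>j. real (m choose j) * r ^ (2 * j + 1) / real (2 * j + 1)"] by simp

text \<open>
  An odd number of signs cannot sum to zero.
\<close>

lemma cube_sup_norm_majority:
  assumes "odd N"
  shows "cube_sup_norm N (majority N) = 1"
proof -
  have "\<bar>majority N x\<bar> = 1" if "x \<in> boolean_cube N" for x
  proof -
    have x: "x \<in> sign_cube {1..N}" using that by (simp add: boolean_cube_def sign_cube_def)
    have "sum x {1..N} \<noteq> 0"
    proof
      assume "sum x {1..N} = 0"
      then have "real N = real (2 * card {i \<in> {1..N}. x i = -1})" using sum_sign_cube[OF _ x] by simp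
      then have "N = 2 * card {i \<in> {1..N}. x i = -1}" by (simp only: of_nat_eq_iff)
      with assms show False by (metis dvd_triv_left)
    qed
    then show ?thesis by (simp add: majority_def abs_sgn_eq)
  qed
  moreover have "(\<lambda>k\<in>{1..N}. 1) \<in> boolean_cube N" by (auto simp: boolean_cube_def)
  ultimately have "(\<lambda>x. \<bar>majority N x\<bar>) ` boolean_cube N = {1}" by force
  then show ?thesis by (simp add: cube_sup_norm_def)
qed

text \<open>
  The defining equation has exactly one positive solution because its left-hand side is strictly
  increasing, vanishes at 0 and, at positive arguments, is never below its tangent at 0; so the
  description in the definition of the radius denotes that solution.
\<close>

lemma boolean_radius_majority:
  fixes m :: nat
  defines "N \<equiv> 2 * m + 1"
  defines "\<rho> \<equiv> boolean_radius N (majority N)"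
  shows "\<rho> > 0" and "real N * central_probability m * power_primitive m \<rho> = 1"
proof -
  define c where "c = real N * central_probability m"
  have c: "c > 0" using central_probability_pos[of m] by (simp add: c_def N_def)
  have radius: "\<rho> = (THE r. r > 0 \<and> c * power_primitive m r = 1)"
    unfolding \<rho>_def boolean_radius_def N_def walsh_majorant_majority
    using cube_sup_norm_majority[of "2 * m + 1"] by (simp add: c_def N_def power_primitive_def)
  have "\<exists>r. 0 \<le> r \<and> r \<le> 1 / c \<and> power_primitive m r = 1 / c"
    using power_primitive_ge[of "1 / c" m] c
    by (intro IVT) (auto intro: DERIV_isCont[OF has_derivative_power_primitive])
  then obtain r where r: "r \<ge> 0" "power_primitive m r = 1 / c" by blast
  have "r \<noteq> 0" using r c by auto
  have "0 < \<rho> \<and> c * power_primitive m \<rho> = 1" unfolding radius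
  proof (rule theI[of _ r], intro conjI)
    show "0 < r" using r \<open>r \<noteq> 0\<close> by simp
    show "c * power_primitive m r = 1" using r c by simp
  next
    fix s assume s: "0 < s \<and> c * power_primitive m s = 1"
    then have "power_primitive m s = 1 / c" using c by (simp add: eq_divide_eq mult.commute)
    then have "power_primitive m s = power_primitive m r" using r by simp
    then show "s = r" using strict_mono_eq[OF strict_mono_power_primitive] by blast
  qed
  then show "\<rho> > 0" and "real N * central_probability m * power_primitive m \<rho> = 1"
    by (simp_all add: c_def)
qed

section \<open>Passage to the limit\<close>

lemma power_tendsto_gaussian:
  fixes u :: real
  shows "(\<lambda>m. (1 + u\<^sup>2 / real (2 * m + 1)) ^ m) \<longlonglongrightarrow> exp (u\<^sup>2 / 2)"
proof -
  \<comment> \<open>\<open>?A m ^ m\<close> is recovered as a square root, since \<open>(?A m ^ m)\<^sup>2 * ?A m = ?A m ^ (2 * m + 1)\<close>.\<close>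
  let ?A = "\<lambda>m. 1 + u\<^sup>2 / real (2 * m + 1)"
  have sub: "filterlim (\<lambda>m. 2 * m + 1 :: nat) sequentially sequentially"
    by (intro filterlim_subseq strict_monoI) simp
  have "(\<lambda>m. ?A m ^ (2 * m + 1)) \<longlonglongrightarrow> exp (u\<^sup>2)"
    using filterlim_compose[OF tendsto_exp_limit_sequentially[of "u\<^sup>2"] sub] by simp
  moreover have "?A \<longlonglongrightarrow> 1 + 0"
    by (intro tendsto_add tendsto_const real_tendsto_divide_at_top[OF tendsto_const]
        filterlim_compose[OF filterlim_real_sequentially sub])
  ultimately have "(\<lambda>m. sqrt (?A m ^ (2 * m + 1) / ?A m)) \<longlonglongrightarrow> sqrt (exp (u\<^sup>2) / (1 + 0))"
    by (intro tendsto_real_sqrt tendsto_divide) auto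
  moreover have "sqrt (?A m ^ (2 * m + 1) / ?A m) = ?A m ^ m" for m
  proof -
    have "?A m > 0" by (intro add_pos_nonneg) auto
    then show ?thesis by (simp add: real_sqrt_unique power_mult[symmetric] mult.commute)
  qed
  moreover have "sqrt (exp (u\<^sup>2) / (1 + 0)) = exp (u\<^sup>2 / 2)"
    by (rule real_sqrt_unique) (simp_all flip: exp_of_nat_mult)
  ultimately show ?thesis by simp
qed

lemma power_le_gaussian:
  fixes u :: real
  shows "(1 + u\<^sup>2 / real (2 * m + 1)) ^ m \<le> exp (u\<^sup>2 / 2)"
proof -
  have "(1 + u\<^sup>2 / real (2 * m + 1)) ^ m \<le> exp (u\<^sup>2 / real (2 * m + 1)) ^ m"
    by (intro power_mono exp_ge_add_one_self add_nonneg_nonneg) auto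
  also have "\<dots> = exp (real m * (u\<^sup>2 / real (2 * m + 1)))" by (rule exp_of_nat_mult[symmetric])
  also have "\<dots> \<le> exp (u\<^sup>2 / 2)" by (simp add: field_simps)
  finally show ?thesis .
qed

text \<open>
  Dominated convergence on \<open>{0..g}\<close>, where \<open>exp (u\<^sup>2 / 2)\<close> is both the limit of the integrands and
  their bound. The factor \<open>2 * m + 1\<close> splits into two square roots: one belongs to the
  asymptotics of the central probability, the other to the substitution \<open>t = u / sqrt (2 * m + 1)\<close>.
\<close>

lemma scaled_power_primitive_tendsto:
  assumes F: "\<And>u. (F has_real_derivative exp (u\<^sup>2 / 2)) (at u)" and g: "g \<ge> 0"
  shows "(\<lambda>m. real (2 * m + 1) * central_probability m * power_primitive m (g / sqrt (real (2 * m + 1))))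
    \<longlonglongrightarrow> sqrt (2 / pi) * (F g - F 0)"
proof -
  define p where "p m u = sqrt (real (2 * m + 1)) * power_primitive m (u / sqrt (real (2 * m + 1)))" for m u
  have "(p m has_real_derivative (1 + u\<^sup>2 / real (2 * m + 1)) ^ m) (at u)" for m u
  proof -
    have "(p m has_real_derivative sqrt (real (2 * m + 1)) *
        ((1 + (u / sqrt (real (2 * m + 1)))\<^sup>2) ^ m * (1 / sqrt (real (2 * m + 1))))) (at u)"
      unfolding p_def
      by (intro DERIV_cmult DERIV_chain2[OF has_derivative_power_primitive] DERIV_cdivide DERIV_ident)
    then show ?thesis by (simp add: power_divide)
  qed
  then have int: "((\<lambda>u. (1 + u\<^sup>2 / real (2 * m + 1)) ^ m) has_integral p m g - p m 0) {0..g}" for m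
    using g by (intro fundamental_theorem_of_calculus)
      (auto simp flip: has_real_derivative_iff_has_vector_derivative intro: DERIV_subset)
  have int': "((\<lambda>u. exp (u\<^sup>2 / 2)) has_integral F g - F 0) {0..g}"
    using F g by (intro fundamental_theorem_of_calculus)
      (auto simp flip: has_real_derivative_iff_has_vector_derivative intro: DERIV_subset)
  have "(\<lambda>m. integral {0..g} (\<lambda>u. (1 + u\<^sup>2 / real (2 * m + 1)) ^ m)) \<longlonglongrightarrow> integral {0..g} (\<lambda>u. exp (u\<^sup>2 / 2))"
  proof (rule dominated_convergence(2))
    show "(\<lambda>u. (1 + u\<^sup>2 / real (2 * m + 1)) ^ m) integrable_on {0..g}" for m using int by blast
    show "(\<lambda>u. exp (u\<^sup>2 / 2)) integrable_on {0..g}" using int' by blast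
    show "norm ((1 + u\<^sup>2 / real (2 * m + 1)) ^ m) \<le> exp (u\<^sup>2 / 2)" for m and u :: real
      using power_le_gaussian[of u m] by simp
  qed (rule power_tendsto_gaussian)
  then have "(\<lambda>m. p m g) \<longlonglongrightarrow> F g - F 0"
    using integral_unique[OF int] integral_unique[OF int'] by (simp add: p_def)
  from tendsto_mult[OF central_probability_tendsto this] show ?thesis
    by (simp add: p_def mult_ac flip: mult.assoc)
qed


text \<open>
  Let \<open>\<Phi> m g\<close> be the value of the defining function at \<open>g / sqrt (2 * m + 1)\<close>, so that the rescaled
  radius is the point where \<open>\<Phi> m\<close> equals 1. If \<open>0 \<le> a < \<gamma>\<close>, then \<open>\<Phi> m a\<close> converges to a limit below 1,
  hence \<open>\<Phi> m a < 1\<close> for large \<open>m\<close>, and by monotonicity \<open>a\<close> lies below the rescaled radius. The case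
  \<open>a > \<gamma>\<close> is symmetric.
\<close>

lemma scaled_boolean_radius_majority_tendsto:
  assumes F: "\<And>u. (F has_real_derivative exp (u\<^sup>2 / 2)) (at u)"
    and \<gamma>: "F \<gamma> - F 0 = sqrt (pi / 2)"
  shows "(\<lambda>m. sqrt (real (2 * m + 1)) * boolean_radius (2 * m + 1) (majority (2 * m + 1))) \<longlonglongrightarrow> \<gamma>"
proof -
  define \<Phi> where "\<Phi> m g = real (2 * m + 1) * central_probability m * power_primitive m (g / sqrt (real (2 * m + 1)))"
    for m g
  define r where "r = (\<lambda>m. sqrt (real (2 * m + 1)) * boolean_radius (2 * m + 1) (majority (2 * m + 1)))"
  have mono: "strict_mono F" by (rule strict_mono_if_derivative_pos[OF F]) simp
  have pi1: "sqrt (2 / pi) * sqrt (pi / 2) = 1" by (simp flip: real_sqrt_mult)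
  have \<Phi>_less: "\<Phi> m g < \<Phi> m g' \<longleftrightarrow> g < g'" for m g g'
    using central_probability_pos[of m]
    by (simp add: \<Phi>_def strict_mono_less[OF strict_mono_power_primitive] divide_less_cancel)
  have \<Phi>_r: "\<Phi> m (r m) = 1" for m
    using boolean_radius_majority(2)[of m] by (simp add: \<Phi>_def r_def)
  have r_pos: "r m > 0" for m
    using boolean_radius_majority(1)[of m] by (simp add: r_def)
  have lim: "(\<lambda>m. \<Phi> m g) \<longlonglongrightarrow> sqrt (2 / pi) * (F g - F 0)" if "g \<ge> 0" for g
    unfolding \<Phi>_def using F that by (rule scaled_power_primitive_tendsto)
  have "r \<longlonglongrightarrow> \<gamma>"
  proof (rule order_tendstoI)
    fix a assume a: "a < \<gamma>"
    show "\<forall>\<^sub>F m in sequentially. a < r m"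
    proof (cases "a < 0")
      case True
      then show ?thesis using r_pos by (intro always_eventually) (meson less_trans)
    next
      case False
      have "sqrt (2 / pi) * (F a - F 0) < sqrt (2 / pi) * sqrt (pi / 2)"
        using strict_monoD[OF mono a] \<gamma> by (intro mult_strict_left_mono) auto
      with lim[of a] False have "\<forall>\<^sub>F m in sequentially. \<Phi> m a < 1"
        by (intro order_tendstoD(2)) (auto simp: pi1)
      then show ?thesis by eventually_elim (metis \<Phi>_r \<Phi>_less)
    qed
  next
    fix a assume a: "a > \<gamma>"
    have "\<gamma> > 0" using \<gamma> strict_mono_less[OF mono, of 0 \<gamma>] real_sqrt_gt_zero[OF pi_half_gt_zero] by linarith
    have "sqrt (2 / pi) * sqrt (pi / 2) < sqrt (2 / pi) * (F a - F 0)"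
      using strict_monoD[OF mono a] \<gamma> by (intro mult_strict_left_mono) auto
    with lim[of a] a \<open>\<gamma> > 0\<close> have "\<forall>\<^sub>F m in sequentially. 1 < \<Phi> m a"
      by (intro order_tendstoD(1)) (auto simp: pi1)
    then show "\<forall>\<^sub>F m in sequentially. r m < a"
      by eventually_elim (metis \<Phi>_r \<Phi>_less)
  qed
  then show ?thesis by (simp only: r_def)
qed

theorem corollary5p10:
  shows "\<exists>\<gamma>::real. \<gamma> > 0 \<and>
    (\<forall>g::real. (LBINT u=ereal 0..ereal g. exp (u\<^sup>2 / 2)) = sqrt (pi / 2) \<longleftrightarrow> g = \<gamma>) \<and>
    asymp_equiv (\<lambda>N::nat. boolean_radius N (majority N))
      (inf at_top (principal {N. odd N}))
      (\<lambda>N. \<gamma> / sqrt (real N))"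
proof -
  obtain F :: "real \<Rightarrow> real" where F: "\<And>u. (F has_real_derivative exp (u\<^sup>2 / 2)) (at u)"
    using einterval_antiderivative[of "-\<infinity>" "\<infinity>" "\<lambda>u. exp (u\<^sup>2 / 2)"]
    by (auto simp: has_real_derivative_iff_has_vector_derivative)
  have mono: "strict_mono F" by (rule strict_mono_if_derivative_pos[OF F]) simp
  have LBINT: "(LBINT u=ereal 0..ereal g. exp (u\<^sup>2 / 2)) = F g - F 0" for g :: real
    using F by (intro interval_integral_FTC_finite continuous_intros)
      (auto simp flip: has_real_derivative_iff_has_vector_derivative intro: DERIV_subset)
  \<comment> \<open>The integrand is at least 1, so the integral up to 2 is at least 2, which exceeds \<open>sqrt (pi / 2)\<close>.\<close>
  obtain z where z: "F 2 - F 0 = (2 - 0) * exp (z\<^sup>2 / 2)"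
    using MVT2[of 0 2 F "\<lambda>u. exp (u\<^sup>2 / 2)"] F by auto
  have "sqrt (pi / 2) \<le> 2" using pi_less_4 by (intro real_le_lsqrt) auto
  also have "2 \<le> F 2 - F 0" using z by simp
  finally have "\<exists>\<gamma>\<ge>0. \<gamma> \<le> 2 \<and> F \<gamma> = F 0 + sqrt (pi / 2)"
    by (intro IVT) (auto intro: DERIV_isCont[OF F])
  then obtain \<gamma> where "F \<gamma> = F 0 + sqrt (pi / 2)" by blast
  then have \<gamma>: "F \<gamma> - F 0 = sqrt (pi / 2)" by simp
  have pos: "\<gamma> > 0" using \<gamma> strict_mono_less[OF mono, of 0 \<gamma>] real_sqrt_gt_zero[OF pi_half_gt_zero] by linarith
  have unique: "F g - F 0 = sqrt (pi / 2) \<longleftrightarrow> g = \<gamma>" for g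
    using \<gamma> strict_mono_eq[OF mono, of g \<gamma>] by auto
  \<comment> \<open>For odd \<open>N\<close> one has \<open>N = 2 * (N div 2) + 1\<close>, which turns the limit in \<open>m\<close> into a limit along odd \<open>N\<close>.\<close>
  have half: "filterlim (\<lambda>N::nat. N div 2) at_top (inf at_top (principal {N. odd N}))"
  proof (rule filterlim_mono[OF _ order_refl inf_le1])
    show "filterlim (\<lambda>N::nat. N div 2) at_top at_top"
      unfolding filterlim_at_top
    proof
      fix Z :: nat
      show "\<forall>\<^sub>F N in at_top. Z \<le> N div 2"
        using eventually_ge_at_top[of "2 * Z"] by eventually_elim auto
    qed
  qed
  let ?r = "\<lambda>N. sqrt (real N) * boolean_radius N (majority N)"
  have "\<forall>\<^sub>F N in inf at_top (principal {N. odd N}). ?r (2 * (N div 2) + 1) = ?r N"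
    unfolding eventually_inf_principal mem_Collect_eq
    by (intro always_eventually allI impI) (metis odd_two_times_div_two_succ)
  with filterlim_compose[OF scaled_boolean_radius_majority_tendsto[OF F \<gamma>] half]
  have "(?r \<longlongrightarrow> \<gamma>) (inf at_top (principal {N. odd N}))"
    by (rule Lim_transform_eventually)
  then have "((\<lambda>N. ?r N / \<gamma>) \<longlongrightarrow> \<gamma> / \<gamma>) (inf at_top (principal {N. odd N}))"
    using pos by (intro tendsto_divide tendsto_const) auto
  then have "asymp_equiv (\<lambda>N::nat. boolean_radius N (majority N))
      (inf at_top (principal {N. odd N})) (\<lambda>N. \<gamma> / sqrt (real N))"
    using pos by (intro asymp_equivI') (simp add: mult.commute)
  with pos unique show ?thesis unfolding LBINT by blast
qed

end
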